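(* Let $\mathfrak{L}$ be an infinite set and $\mathcal{U}$ a free ultrafilter on $\mathfrak{L}$, let $\mathbb{K}$ be the field of $\Lambda$-limits of functions $\mathfrak{L}\to\mathbb{R}$, and suppose that $\mathbb{R}$ is a proper subset of $\mathbb{K}$. Let $\ast:V_\infty(\mathbb{R})\to V_\infty(\mathbb{K})$ be the map $x^\ast=\lim_{\lambda\to\Lambda}(\lambda,x)$ (the $\Lambda$-limit of the constant function with value $x$). Then $(V_\infty(\mathbb{R}),V_\infty(\mathbb{K}),\ast)$ is a nonstandard universe, where truth of formulas in $V_\infty(\mathbb{K})$ is understood as specified in the context (eventual truth of the formula along representing functions).
   Context: "Eventually" means: for all $\lambda$ in some set of $\mathcal{U}$. Superstructure: for an infinite set $E$, $V_0(E)=E$, $V_{n+1}(E)=V_n(E)\cup\mathcal{P}(V_n(E))$, $V_\infty(E)=\bigcup_{n\in\mathbb{N}}V_n(E)$. Field $\mathbb{K}$: for $\varphi:\mathfrak{L}\to\mathbb{R}$, $\lim_{\lambda\to\Lambda}(\lambda,\varphi(\lambda))$ is the class of $\varphi$ modulo eventual equality; $\mathbb{K}$ is the set of all these classes (i.e. the ultrapower $\mathbb{R}^{\mathfrak{L}}/\mathcal{U}$ with componentwise operations), and $c\in\mathbb{R}$ is identified with the class of the constant function $c$, so $\mathbb{R}\subseteq\mathbb{K}$. $\Lambda$-limits in the superstructure: a function $\varphi:\mathfrak{L}\to V_\infty(\mathbb{R})$ is bounded if there is $n$ with $\varphi(\lambda)\in V_n(\mathbb{R})$ for all $\lambda\in\mathfrak{L}$.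 For $\varphi:\mathfrak{L}\to V_n(\mathbb{R})$, $\lim_{\lambda\to\Lambda}(\lambda,\varphi(\lambda))\in V_\infty(\mathbb{K})$ is defined by induction on $n$: for $n=0$ it is the element of $\mathbb{K}$ given above; assuming the limit is defined for $n-1$, $$\lim_{\lambda\to\Lambda}(\lambda,\varphi(\lambda))=\Big\{\lim_{\lambda\to\Lambda}(\lambda,\psi(\lambda))\ \Big|\ \psi:\mathfrak{L}\to V_{n-1}(\mathbb{R})\text{ and }\forall\lambda\in\mathfrak{L},\ \psi(\lambda)\in\varphi(\lambda)\Big\}.$$ Superstructure embedding: a one-to-one map $\ast:V_\infty(\mathbb{R})\to V_\infty(\mathbb{S})$ such that (1) $\mathbb{R}$ is a proper subset of $\mathbb{S}$, $r^\ast=r$ for all $r\in\mathbb{R}$, and $\mathbb{R}^\ast=\mathbb{S}$; (2) for $x,y\in V_\infty(\mathbb{R})$, $x\in y$ if and only if $x^\ast\in y^\ast$. Nonstandard universe: a superstructure embedding $\ast:V_\infty(\mathbb{R})\to V_\infty(\mathbb{R}^\ast)$ satisfying Leibniz' Principle: for each bounded sentence $p\in\mathcal{L}$, $p$ is true in $V_\infty(\mathbb{R})$ if and only if $p^\ast$ is true in $V_\infty(\mathbb{R}^\ast)$. Here $\mathcal{L}$ is a first-order language with equality, a binary relation symbol $\in$, and a constant symbol for each element of $V_\infty(\mathbb{R})$; a sentence is bounded if every quantifier in it is bounded; $p^\ast$ is obtained from $p$ by replacing each constant $c$ by $c^\ast$. Interpretation of formulas in $V_\infty(\mathbb{K})$: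 let $p(x_1,\dots,x_n)\in\mathcal{L}$ be a bounded formula with $x_1,\dots,x_n$ as its only free variables, and let $\xi_i=\lim_{\lambda\to\Lambda}(\lambda,\varphi_i(\lambda))$ for $i=1,\dots,n$. One says that $p^\ast(\xi_1,\dots,\xi_n)$ holds in $V_\infty(\mathbb{K})$ iff $p(\varphi_1(\lambda),\dots,\varphi_n(\lambda))$ is eventually true in $V_\infty(\mathbb{R})$, i.e. iff $\{\lambda\in\mathfrak{L}\mid p(\varphi_1(\lambda),\dots,\varphi_n(\lambda))\text{ holds in }V_\infty(\mathbb{R})\}\in\mathcal{U}$.
   Formalization: In the Λ-limit, "for all λ, ψ(λ) ∈ φ(λ)" is read as "eventually", and a φ eventually valued in a lower level keeps its limit from that level; literally the claim fails: for x = {r,{s}} one would get ∅* ∈ x* although ∅ ∉ x. *)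

theory Defs
  imports Complex_Main "HOL-Algebra.Ring"
begin

definition free_ultrafilter :: "'l filter \<Rightarrow> bool" where
  "free_ultrafilter U \<longleftrightarrow>
     U \<noteq> bot \<and>
     (\<forall>P. eventually P U \<or> eventually (\<lambda>l. \<not> P l) U) \<and>
     \<Inter>{A. eventually (\<lambda>l. l \<in> A) U} = {}"

definition ev_eq :: "'l filter \<Rightarrow> (('l \<Rightarrow> real) \<times> ('l \<Rightarrow> real)) set" where
  "ev_eq U = {(f, g). eventually (\<lambda>l. f l = g l) U}"

definition real_Lim :: "'l filter \<Rightarrow> ('l \<Rightarrow> real) \<Rightarrow> ('l \<Rightarrow> real) set" where
  "real_Lim U f = ev_eq U `` {f}"

definition Lambda_field :: "'l filter \<Rightarrow> ('l \<Rightarrow> real) set ring" where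
  "Lambda_field U =
     \<lparr>carrier = UNIV // ev_eq U,
      mult = (\<lambda>X Y. \<Union>f\<in>X. \<Union>g\<in>Y. real_Lim U (\<lambda>l. f l * g l)),
      one = real_Lim U (\<lambda>_. 1),
      zero = real_Lim U (\<lambda>_. 0),
      add = (\<lambda>X Y. \<Union>f\<in>X. \<Union>g\<in>Y. real_Lim U (\<lambda>l. f l + g l))\<rparr>"

definition const_Lim :: "'l filter \<Rightarrow> real \<Rightarrow> ('l \<Rightarrow> real) set" where
  "const_Lim U c = real_Lim U (\<lambda>_. c)"

lemma equiv_ev_eq: "equiv UNIV (ev_eq U)"
proof (rule equivI)
  show "refl (ev_eq U)" by (simp add: refl_on_def ev_eq_def)
  show "sym (ev_eq U)" by (simp add: sym_def ev_eq_def eq_commute)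
  show "trans (ev_eq U)"
  proof (rule transI)
    fix f g h assume "(f, g) \<in> ev_eq U" "(g, h) \<in> ev_eq U"
    then have "eventually (\<lambda>l. f l = g l) U" "eventually (\<lambda>l. g l = h l) U"
      by (simp_all add: ev_eq_def)
    then have "eventually (\<lambda>l. f l = h l) U" by eventually_elim simp
    then show "(f, h) \<in> ev_eq U" by (simp add: ev_eq_def)
  qed
qed simp

lemma real_Lim_eq_iff: "real_Lim U f = real_Lim U g \<longleftrightarrow> eventually (\<lambda>l. f l = g l) U"
  unfolding real_Lim_def
  using eq_equiv_class_iff[OF equiv_ev_eq, of f g U] by (simp add: ev_eq_def)

lemma self_in_real_Lim: "f \<in> real_Lim U f"
  by (simp add: real_Lim_def ev_eq_def)

lemma carrier_Lambda_field: "carrier (Lambda_field U) = range (real_Lim U)"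
  by (auto simp: Lambda_field_def quotient_def real_Lim_def)

lemma mult_real_Lim:
  "real_Lim U f \<otimes>\<^bsub>Lambda_field U\<^esub> real_Lim U g = real_Lim U (\<lambda>l. f l * g l)"
proof -
  have "real_Lim U (\<lambda>l. f' l * g' l) = real_Lim U (\<lambda>l. f l * g l)"
    if "f' \<in> real_Lim U f" "g' \<in> real_Lim U g" for f' g'
  proof -
    have "eventually (\<lambda>l. f l = f' l) U" "eventually (\<lambda>l. g l = g' l) U"
      using that by (simp_all add: real_Lim_def ev_eq_def)
    then show ?thesis
      unfolding real_Lim_eq_iff by eventually_elim simp
  qed
  then have "(\<Union>f'\<in>real_Lim U f. \<Union>g'\<in>real_Lim U g. real_Lim U (\<lambda>l. f' l * g' l))
      = real_Lim U (\<lambda>l. f l * g l)"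
    using self_in_real_Lim[of f U] self_in_real_Lim[of g U] by blast
  then show ?thesis
    by (simp add: Lambda_field_def)
qed

lemma add_real_Lim:
  "real_Lim U f \<oplus>\<^bsub>Lambda_field U\<^esub> real_Lim U g = real_Lim U (\<lambda>l. f l + g l)"
proof -
  have "real_Lim U (\<lambda>l. f' l + g' l) = real_Lim U (\<lambda>l. f l + g l)"
    if "f' \<in> real_Lim U f" "g' \<in> real_Lim U g" for f' g'
  proof -
    have "eventually (\<lambda>l. f l = f' l) U" "eventually (\<lambda>l. g l = g' l) U"
      using that by (simp_all add: real_Lim_def ev_eq_def)
    then show ?thesis
      unfolding real_Lim_eq_iff by eventually_elim simp
  qed
  then have "(\<Union>f'\<in>real_Lim U f. \<Union>g'\<in>real_Lim U g. real_Lim U (\<lambda>l. f' l + g' l))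
      = real_Lim U (\<lambda>l. f l + g l)"
    using self_in_real_Lim[of f U] self_in_real_Lim[of g U] by blast
  then show ?thesis
    by (simp add: Lambda_field_def)
qed

lemma one_Lambda_field: "\<one>\<^bsub>Lambda_field U\<^esub> = real_Lim U (\<lambda>_. 1)"
  and zero_Lambda_field: "\<zero>\<^bsub>Lambda_field U\<^esub> = real_Lim U (\<lambda>_. 0)"
  by (simp_all add: Lambda_field_def)

lemmas Lambda_field_simps =
  carrier_Lambda_field mult_real_Lim add_real_Lim one_Lambda_field zero_Lambda_field

lemma field_Lambda_field:
  assumes "free_ultrafilter U"
  shows "field (Lambda_field U)"
proof -
  have U: "U \<noteq> bot" "\<And>P. eventually P U \<or> eventually (\<lambda>l. \<not> P l) U"
    using assms by (auto simp: free_ultrafilter_def)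
  have cr: "cring (Lambda_field U)"
  proof (rule cringI)
    show "abelian_group (Lambda_field U)"
    proof (rule abelian_groupI)
      fix x assume "x \<in> carrier (Lambda_field U)"
      then obtain f where f: "x = real_Lim U f" by (auto simp: Lambda_field_simps)
      show "\<exists>y\<in>carrier (Lambda_field U). y \<oplus>\<^bsub>Lambda_field U\<^esub> x = \<zero>\<^bsub>Lambda_field U\<^esub>"
        by (rule bexI[of _ "real_Lim U (\<lambda>l. - f l)"]) (auto simp: Lambda_field_simps f)
    qed (auto simp: Lambda_field_simps algebra_simps)
    show "comm_monoid (Lambda_field U)"
      by (rule comm_monoidI) (auto simp: Lambda_field_simps algebra_simps)
  qed (auto simp: Lambda_field_simps algebra_simps)
  show ?thesis
  proof (rule cring.cring_fieldI2[OF cr])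
    show "\<zero>\<^bsub>Lambda_field U\<^esub> \<noteq> \<one>\<^bsub>Lambda_field U\<^esub>"
      using U(1) by (simp add: Lambda_field_simps real_Lim_eq_iff)
  next
    fix a assume a: "a \<in> carrier (Lambda_field U)" "a \<noteq> \<zero>\<^bsub>Lambda_field U\<^esub>"
    then obtain f where f: "a = real_Lim U f" by (auto simp: Lambda_field_simps)
    have "eventually (\<lambda>l. f l \<noteq> 0) U"
      using a(2) U(2)[of "\<lambda>l. f l = 0"] by (simp add: f Lambda_field_simps real_Lim_eq_iff)
    then have "eventually (\<lambda>l. f l * inverse (f l) = 1) U"
      by (rule eventually_mono) simp
    then show "\<exists>b\<in>carrier (Lambda_field U). a \<otimes>\<^bsub>Lambda_field U\<^esub> b = \<one>\<^bsub>Lambda_field U\<^esub>"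
      by (intro bexI[of _ "real_Lim U (\<lambda>l. inverse (f l))"])
        (auto simp: Lambda_field_simps f real_Lim_eq_iff)
  qed
qed

text \<open>
  HOL has no type that provably contains all finite levels of the superstructure over an
  infinite set, so superstructures live in an arbitrary type \<open>'v\<close> that comes with a
  map \<open>St\<close>; the value \<open>St X\<close> is the object of \<open>'v\<close> that
  represents the set \<open>X\<close>.
  The predicate \<open>superstructure_over St E\<close> says that, over the base set \<open>E\<close>,
  this representation is extensional on all subsets of all levels and that base elements are
  urelements, i.e. none of them is a set.  In particular each \<open>V St E n\<close> has all of
  its subsets represented in the next level.
\<close>

primrec V :: "('v set \<Rightarrow> 'v) \<Rightarrow> 'v set \<Rightarrow> nat \<Rightarrow> 'v set" where
  "V St E 0 = E"
| "V St E (Suc n) = V St E n \<union> St ` Pow (V St E n)"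

definition V_inf :: "('v set \<Rightarrow> 'v) \<Rightarrow> 'v set \<Rightarrow> 'v set" where
  "V_inf St E = (\<Union>n. V St E n)"

definition superstructure_over :: "('v set \<Rightarrow> 'v) \<Rightarrow> 'v set \<Rightarrow> bool" where
  "superstructure_over St E \<longleftrightarrow>
     (\<forall>n. inj_on St (Pow (V St E n))) \<and> (\<forall>n. E \<inter> St ` Pow (V St E n) = {})"

definition mem :: "('v set \<Rightarrow> 'v) \<Rightarrow> 'v set \<Rightarrow> 'v \<Rightarrow> 'v \<Rightarrow> bool" where
  "mem St E x y \<longleftrightarrow> (\<exists>n. \<exists>X \<subseteq> V St E n. y = St X \<and> x \<in> X)"

datatype 'c trm = Var nat | Const 'c

datatype 'c fm =
    Eq "'c trm" "'c trm"
  | Mem "'c trm" "'c trm"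
  | Neg "'c fm"
  | And "'c fm" "'c fm"
  | Or "'c fm" "'c fm"
  | Imp "'c fm" "'c fm"
  | All nat "'c fm"
  | Ex nat "'c fm"

primrec tvars :: "'c trm \<Rightarrow> nat set" where
  "tvars (Var i) = {i}"
| "tvars (Const c) = {}"

primrec fvars :: "'c fm \<Rightarrow> nat set" where
  "fvars (Eq s t) = tvars s \<union> tvars t"
| "fvars (Mem s t) = tvars s \<union> tvars t"
| "fvars (Neg p) = fvars p"
| "fvars (And p q) = fvars p \<union> fvars q"
| "fvars (Or p q) = fvars p \<union> fvars q"
| "fvars (Imp p q) = fvars p \<union> fvars q"
| "fvars (All i p) = fvars p - {i}"
| "fvars (Ex i p) = fvars p - {i}"

inductive bounded_fm :: "'c fm \<Rightarrow> bool" where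
  "bounded_fm (Eq s t)"
| "bounded_fm (Mem s t)"
| "bounded_fm p \<Longrightarrow> bounded_fm (Neg p)"
| "bounded_fm p \<Longrightarrow> bounded_fm q \<Longrightarrow> bounded_fm (And p q)"
| "bounded_fm p \<Longrightarrow> bounded_fm q \<Longrightarrow> bounded_fm (Or p q)"
| "bounded_fm p \<Longrightarrow> bounded_fm q \<Longrightarrow> bounded_fm (Imp p q)"
| "i \<notin> tvars t \<Longrightarrow> bounded_fm p \<Longrightarrow> bounded_fm (All i (Imp (Mem (Var i) t) p))"
| "i \<notin> tvars t \<Longrightarrow> bounded_fm p \<Longrightarrow> bounded_fm (Ex i (And (Mem (Var i) t) p))"

primrec tval :: "(nat \<Rightarrow> 'v) \<Rightarrow> 'v trm \<Rightarrow> 'v" where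
  "tval e (Var i) = e i"
| "tval e (Const c) = c"

primrec sat :: "'v set \<Rightarrow> ('v \<Rightarrow> 'v \<Rightarrow> bool) \<Rightarrow> 'v fm \<Rightarrow> (nat \<Rightarrow> 'v) \<Rightarrow> bool" where
  "sat M \<epsilon> (Eq s t) e \<longleftrightarrow> tval e s = tval e t"
| "sat M \<epsilon> (Mem s t) e \<longleftrightarrow> \<epsilon> (tval e s) (tval e t)"
| "sat M \<epsilon> (Neg p) e \<longleftrightarrow> \<not> sat M \<epsilon> p e"
| "sat M \<epsilon> (And p q) e \<longleftrightarrow> sat M \<epsilon> p e \<and> sat M \<epsilon> q e"
| "sat M \<epsilon> (Or p q) e \<longleftrightarrow> sat M \<epsilon> p e \<or> sat M \<epsilon> q e"
| "sat M \<epsilon> (Imp p q) e \<longleftrightarrow> (sat M \<epsilon> p e \<longrightarrow> sat M \<epsilon> q e)"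
| "sat M \<epsilon> (All i p) e \<longleftrightarrow> (\<forall>x\<in>M. sat M \<epsilon> p (e(i := x)))"
| "sat M \<epsilon> (Ex i p) e \<longleftrightarrow> (\<exists>x\<in>M. sat M \<epsilon> p (e(i := x)))"

abbreviation sat_V ::
  "('v set \<Rightarrow> 'v) \<Rightarrow> 'v set \<Rightarrow> 'v fm \<Rightarrow> (nat \<Rightarrow> 'v) \<Rightarrow> bool" where
  "sat_V St E \<equiv> sat (V_inf St E) (mem St E)"

definition superstructure_embedding ::
  "('v set \<Rightarrow> 'v) \<Rightarrow> 'v set \<Rightarrow> 'v set \<Rightarrow> ('v \<Rightarrow> 'v) \<Rightarrow> bool" where
  "superstructure_embedding St R S star \<longleftrightarrow>
     star ` V_inf St R \<subseteq> V_inf St S \<and> inj_on star (V_inf St R) \<and>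
     R \<subset> S \<and> (\<forall>r\<in>R. star r = r) \<and> star (St R) = St S \<and>
     (\<forall>x\<in>V_inf St R. \<forall>y\<in>V_inf St R. mem St R x y \<longleftrightarrow> mem St S (star x) (star y))"

text \<open>
  The argument \<open>T\<close> is the notion of truth used in the second superstructure;
  \<open>map_fm star p\<close> replaces each constant \<open>c\<close> of \<open>p\<close> by
  \<open>star c\<close>.
\<close>

definition nonstandard_universe ::
  "('v set \<Rightarrow> 'v) \<Rightarrow> 'v set \<Rightarrow> 'v set \<Rightarrow> ('v \<Rightarrow> 'v) \<Rightarrow>
     ('v fm \<Rightarrow> (nat \<Rightarrow> 'v) \<Rightarrow> bool) \<Rightarrow> bool" where
  "nonstandard_universe St R S star T \<longleftrightarrow>
     superstructure_embedding St R S star \<and>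
     (\<forall>p. bounded_fm p \<and> fvars p = {} \<and> set_fm p \<subseteq> V_inf St R \<longrightarrow>
        ((\<forall>e \<in> UNIV \<rightarrow> V_inf St R. sat_V St R p e) \<longleftrightarrow>
         (\<forall>e \<in> UNIV \<rightarrow> V_inf St S. T (map_fm star p) e)))"

text \<open>
  In what follows \<open>\<kappa>\<close> places the classes that make up the field of limits into
  the type \<open>'v\<close> as urelements, and a real number is identified with its constant class.
\<close>

definition K_atoms :: "'l filter \<Rightarrow> (('l \<Rightarrow> real) set \<Rightarrow> 'v) \<Rightarrow> 'v set" where
  "K_atoms U \<kappa> = \<kappa> ` carrier (Lambda_field U)"

definition real_atom :: "'l filter \<Rightarrow> (('l \<Rightarrow> real) set \<Rightarrow> 'v) \<Rightarrow> real \<Rightarrow> 'v" where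
  "real_atom U \<kappa> c = \<kappa> (const_Lim U c)"

definition R_atoms :: "'l filter \<Rightarrow> (('l \<Rightarrow> real) set \<Rightarrow> 'v) \<Rightarrow> 'v set" where
  "R_atoms U \<kappa> = range (real_atom U \<kappa>)"

text \<open>
  The limit of \<open>\<phi>\<close> into level \<open>n\<close>.  A function into
  \<open>V\<^sub>n\<^sub>+\<^sub>1\<close> that eventually takes values in \<open>V\<^sub>n\<close>
  keeps its limit from level \<open>n\<close>, and otherwise the limit is the set of the limits of
  the \<open>\<psi>\<close> into \<open>V\<^sub>n\<close> that select an element of \<open>\<phi>\<close>.
  Selection is required eventually: if it were required at every index, a single index at
  which \<open>\<phi>\<close> is a real number or the empty set would make the limit empty, so that
  the limit would not respect eventual equality and, for real \<open>r\<close> and \<open>s\<close>,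
  the image of \<open>{r, {s}}\<close> would contain the empty set.
  If each value of \<open>\<phi>\<close> is a nonempty set, both readings give the same limit.
\<close>

primrec Lim_level ::
  "('v set \<Rightarrow> 'v) \<Rightarrow> 'l filter \<Rightarrow> (('l \<Rightarrow> real) set \<Rightarrow> 'v) \<Rightarrow> nat \<Rightarrow> ('l \<Rightarrow> 'v) \<Rightarrow> 'v" where
  "Lim_level St U \<kappa> 0 \<phi> = \<kappa> (real_Lim U (\<lambda>l. inv_into UNIV (real_atom U \<kappa>) (\<phi> l)))"
| "Lim_level St U \<kappa> (Suc n) \<phi> =
     (if eventually (\<lambda>l. \<phi> l \<in> V St (R_atoms U \<kappa>) n) U
      then Lim_level St U \<kappa> n \<phi>
      else St {Lim_level St U \<kappa> n \<psi> | \<psi>.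
                 (\<forall>l. \<psi> l \<in> V St (R_atoms U \<kappa>) n) \<and>
                 eventually (\<lambda>l. mem St (R_atoms U \<kappa>) (\<psi> l) (\<phi> l)) U})"

definition bounded_fun ::
  "('v set \<Rightarrow> 'v) \<Rightarrow> 'l filter \<Rightarrow> (('l \<Rightarrow> real) set \<Rightarrow> 'v) \<Rightarrow> ('l \<Rightarrow> 'v) \<Rightarrow> bool" where
  "bounded_fun St U \<kappa> \<phi> \<longleftrightarrow> (\<exists>n. \<forall>l. \<phi> l \<in> V St (R_atoms U \<kappa>) n)"

definition Lambda_Lim ::
  "('v set \<Rightarrow> 'v) \<Rightarrow> 'l filter \<Rightarrow> (('l \<Rightarrow> real) set \<Rightarrow> 'v) \<Rightarrow> ('l \<Rightarrow> 'v) \<Rightarrow> 'v" where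
  "Lambda_Lim St U \<kappa> \<phi> =
     Lim_level St U \<kappa> (LEAST n. \<forall>l. \<phi> l \<in> V St (R_atoms U \<kappa>) n) \<phi>"

definition Lambda_star ::
  "('v set \<Rightarrow> 'v) \<Rightarrow> 'l filter \<Rightarrow> (('l \<Rightarrow> real) set \<Rightarrow> 'v) \<Rightarrow> 'v \<Rightarrow> 'v" where
  "Lambda_star St U \<kappa> x = Lambda_Lim St U \<kappa> (\<lambda>_. x)"

text \<open>
  \<open>q\<close> is read as \<open>p\<^sup>*\<close> for a bounded formula \<open>p\<close> with constants from the
  superstructure over the reals, and the values of its free variables as limits of bounded
  functions; it holds iff \<open>p\<close> eventually holds along these functions.
\<close>

definition Lambda_holds ::
  "('v set \<Rightarrow> 'v) \<Rightarrow> 'l filter \<Rightarrow> (('l \<Rightarrow> real) set \<Rightarrow> 'v) \<Rightarrow>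
     'v fm \<Rightarrow> (nat \<Rightarrow> 'v) \<Rightarrow> bool" where
  "Lambda_holds St U \<kappa> q \<xi> \<longleftrightarrow>
     (\<exists>p \<phi>. bounded_fm p \<and> set_fm p \<subseteq> V_inf St (R_atoms U \<kappa>) \<and>
        q = map_fm (Lambda_star St U \<kappa>) p \<and>
        (\<forall>i\<in>fvars p. bounded_fun St U \<kappa> (\<phi> i) \<and> \<xi> i = Lambda_Lim St U \<kappa> (\<phi> i)) \<and>
        eventually (\<lambda>l. sat_V St (R_atoms U \<kappa>) p (\<lambda>i. \<phi> i l)) U)"

end

(* Truth in the second superstructure is eventual truth along representing functions, so Leibniz'
   principle for sentences only needs that star is injective, which makes the representing sentence
   unique.  The content lies in the embedding: by induction on the level, two functions have equal
   limits iff they are eventually equal.  An ultrafilter decides whether the values are eventually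
   urelements or eventually sets, and a function that eventually picks an element of the symmetric
   difference of two functions separates their limits. *)
theory Submission
  imports Defs
begin

section \<open>Levels of a superstructure, extensionality and membership\<close>

lemma V_mono_level: "m \<le> n \<Longrightarrow> V St E m \<subseteq> V St E n"
  by (rule lift_Suc_mono_le[of "V St E"]) auto

lemma V_mono_base: "E \<subseteq> F \<Longrightarrow> V St E n \<subseteq> V St F n"
  by (induction n) (auto intro!: imageI)

text \<open>The sets formed at earlier stages reappear among the subsets of the larger level, so
  only urelements and subsets of the preceding level remain. All later case distinctions on values
  rest on this dichotomy.\<close>

lemma V_Suc_eq: "V St E (Suc n) = E \<union> St ` Pow (V St E n)"
proof (induction n)
  case (Suc n)
  have "St ` Pow (V St E n) \<subseteq> St ` Pow (V St E (Suc n))"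
    by (intro image_mono Pow_mono) auto
  then show ?case
    unfolding V.simps(2)[of St E "Suc n"] using Suc by blast
qed simp

lemma in_V_imp_in_V_inf: "x \<in> V St E n \<Longrightarrow> x \<in> V_inf St E"
  by (auto simp: V_inf_def)

lemma V_inf_cases:
  assumes "x \<in> V_inf St E"
  obtains "x \<in> E" | n X where "X \<subseteq> V St E n" "x = St X"
proof -
  from assms obtain n where n: "x \<in> V St E n"
    by (auto simp: V_inf_def)
  have "x \<in> V St E (Suc n)"
    using n by simp
  then show ?thesis
    unfolding V_Suc_eq using that by blast
qed

text \<open>Levels grow with the base, so injectivity of \<open>St\<close> and disjointness from
  urelements are inherited. This transfers the hypothesis on the hyperreal base to the real
  one.\<close>

lemma superstructure_over_subset:
  assumes "superstructure_over St F" "E \<subseteq> F"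
  shows "superstructure_over St E"
proof -
  have "Pow (V St E n) \<subseteq> Pow (V St F n)" for n
    using V_mono_base[OF assms(2)] by (rule Pow_mono)
  then show ?thesis
    using assms unfolding superstructure_over_def
    by (meson disjoint_iff image_mono inj_on_subset subset_iff)
qed

lemma St_eq_iff:
  assumes "superstructure_over St E" "X \<subseteq> V St E m" "Y \<subseteq> V St E n"
  shows "St X = St Y \<longleftrightarrow> X = Y"
proof -
  have "X \<in> Pow (V St E (max m n))" "Y \<in> Pow (V St E (max m n))"
    using assms(2,3) V_mono_level[of m "max m n" St E] V_mono_level[of n "max m n" St E]
    by auto
  then show ?thesis
    using assms(1) by (metis inj_on_eq_iff superstructure_over_def)
qed

lemma St_notin_base: "superstructure_over St E \<Longrightarrow> X \<subseteq> V St E n \<Longrightarrow> St X \<notin> E"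
  unfolding superstructure_over_def by blast

text \<open>\<open>mem\<close> asks for some set represented by the right-hand argument;
  extensionality across levels leaves only one candidate.\<close>

lemma mem_St_iff:
  assumes "superstructure_over St E" "X \<subseteq> V St E n"
  shows "mem St E x (St X) \<longleftrightarrow> x \<in> X"
  using assms St_eq_iff[OF assms(1) assms(2)] unfolding mem_def by metis

lemma not_mem_base: "superstructure_over St E \<Longrightarrow> y \<in> E \<Longrightarrow> \<not> mem St E x y"
  using St_notin_base unfolding mem_def by metis

section \<open>Truth depends only on the free variables\<close>

lemma tval_cong: "(\<And>i. i \<in> tvars t \<Longrightarrow> e i = e' i) \<Longrightarrow> tval e t = tval e' t"
  by (cases t) auto

lemma sat_cong: "(\<And>i. i \<in> fvars p \<Longrightarrow> e i = e' i) \<Longrightarrow> sat M \<epsilon> p e = sat M \<epsilon> p e'"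
proof (induction p arbitrary: e e')
  case (Eq s t)
  then show ?case using tval_cong[of s e e'] tval_cong[of t e e'] by simp
next
  case (Mem s t)
  then show ?case using tval_cong[of s e e'] tval_cong[of t e e'] by simp
next
  case (Neg p)
  have "sat M \<epsilon> p e = sat M \<epsilon> p e'"
    by (rule Neg.IH) (use Neg.prems in auto)
  then show ?case by simp
next
  case (And p q)
  have "sat M \<epsilon> p e = sat M \<epsilon> p e'"
    by (rule And.IH(1)) (use And.prems in auto)
  moreover have "sat M \<epsilon> q e = sat M \<epsilon> q e'"
    by (rule And.IH(2)) (use And.prems in auto)
  ultimately show ?case by simp
next
  case (Or p q)
  have "sat M \<epsilon> p e = sat M \<epsilon> p e'"
    by (rule Or.IH(1)) (use Or.prems in auto)
  moreover have "sat M \<epsilon> q e = sat M \<epsilon> q e'"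
    by (rule Or.IH(2)) (use Or.prems in auto)
  ultimately show ?case by simp
next
  case (Imp p q)
  have "sat M \<epsilon> p e = sat M \<epsilon> p e'"
    by (rule Imp.IH(1)) (use Imp.prems in auto)
  moreover have "sat M \<epsilon> q e = sat M \<epsilon> q e'"
    by (rule Imp.IH(2)) (use Imp.prems in auto)
  ultimately show ?case by simp
next
  case (All i p)
  have "sat M \<epsilon> p (e(i := x)) = sat M \<epsilon> p (e'(i := x))" for x
    by (rule All.IH) (use All.prems in auto)
  then show ?case by simp
next
  case (Ex i p)
  have "sat M \<epsilon> p (e(i := x)) = sat M \<epsilon> p (e'(i := x))" for x
    by (rule Ex.IH) (use Ex.prems in auto)
  then show ?case by simp
qed

section \<open>Ultrafilter arguments and the two sets of urelements\<close>

locale Lambda_superstructure =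
  fixes U :: "'l filter" and St :: "'v set \<Rightarrow> 'v" and \<kappa> :: "('l \<Rightarrow> real) set \<Rightarrow> 'v"
  assumes free: "free_ultrafilter U"
    and inj_kappa: "inj_on \<kappa> (carrier (Lambda_field U))"
    and sup_K: "superstructure_over St (K_atoms U \<kappa>)"
begin

abbreviation "R \<equiv> R_atoms U \<kappa>"
abbreviation "K \<equiv> K_atoms U \<kappa>"
abbreviation "lvl_lim \<equiv> Lim_level St U \<kappa>"
abbreviation "star \<equiv> Lambda_star St U \<kappa>"

lemma U_not_bot: "U \<noteq> bot"
  using free by (simp add: free_ultrafilter_def)

lemma eventually_or_not: "eventually P U \<or> eventually (\<lambda>l. \<not> P l) U"
  using free by (simp add: free_ultrafilter_def)

lemma eventually_disj_cases:
  assumes "eventually (\<lambda>l. P l \<or> Q l) U"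
  obtains "eventually P U" | "eventually Q U"
proof (cases "eventually P U")
  case False
  then have "eventually (\<lambda>l. \<not> P l) U"
    using eventually_or_not by blast
  then have "eventually Q U"
    using assms by eventually_elim simp
  then show ?thesis by (rule that(2))
qed (rule that(1))

lemma eventually_const_iff: "eventually (\<lambda>_. P) U \<longleftrightarrow> P"
  using U_not_bot by (cases P) (auto simp: eventually_False)

lemma kappa_eq_iff:
  "\<kappa> (real_Lim U f) = \<kappa> (real_Lim U g) \<longleftrightarrow> eventually (\<lambda>l. f l = g l) U"
proof -
  have "real_Lim U f \<in> carrier (Lambda_field U)" "real_Lim U g \<in> carrier (Lambda_field U)"
    by (simp_all add: carrier_Lambda_field)
  then show ?thesis
    by (simp add: inj_on_eq_iff[OF inj_kappa] real_Lim_eq_iff)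
qed

lemma K_eq: "K = range (\<lambda>f. \<kappa> (real_Lim U f))"
  by (auto simp: K_atoms_def carrier_Lambda_field)

lemma R_subset_K: "R \<subseteq> K"
  by (auto simp: K_eq R_atoms_def real_atom_def const_Lim_def)

lemma inj_real_atom: "inj (real_atom U \<kappa>)"
  by (rule injI) (simp add: real_atom_def const_Lim_def kappa_eq_iff eventually_const_iff)

lemma inv_real_atom [simp]: "inv_into UNIV (real_atom U \<kappa>) (real_atom U \<kappa> c) = c"
  by (simp add: inj_real_atom)

lemma sup_R: "superstructure_over St R"
  using superstructure_over_subset[OF sup_K R_subset_K] .

lemma real_atom_in_V: "real_atom U \<kappa> 0 \<in> V St R n"
proof -
  have "real_atom U \<kappa> 0 \<in> V St R 0"
    by (simp add: R_atoms_def)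
  then show ?thesis
    using V_mono_level[of 0 n St R] by blast
qed

text \<open>Selectors in \<open>Lim_level\<close> must stay in the level at every index, whereas
  witnesses exist only eventually. At the remaining indices any element of the level will do, and 0
  shows that there is one.\<close>

lemma eventually_choose:
  assumes "eventually (\<lambda>l. \<exists>x \<in> V St R n. P l x) U"
  obtains \<chi> where "\<And>l. \<chi> l \<in> V St R n" "eventually (\<lambda>l. P l (\<chi> l)) U"
proof -
  have "\<forall>l. \<exists>x. x \<in> V St R n \<and> ((\<exists>x \<in> V St R n. P l x) \<longrightarrow> P l x)"
    using real_atom_in_V by blast
  then obtain \<chi> where \<chi>: "\<And>l. \<chi> l \<in> V St R n"
    "\<And>l. \<exists>x \<in> V St R n. P l x \<Longrightarrow> P l (\<chi> l)"
    by metis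
  have "eventually (\<lambda>l. P l (\<chi> l)) U"
    using assms by eventually_elim (rule \<chi>(2))
  then show ?thesis
    using \<chi>(1) that by blast
qed

section \<open>Limits at a fixed level and their independence of the level\<close>

lemma lim_in_V: "lvl_lim n \<phi> \<in> V St K n"
proof (induction n arbitrary: \<phi>)
  case 0
  then show ?case by (simp add: K_eq)
next
  case (Suc n)
  then show ?case by (auto intro!: imageI)
qed

text \<open>Both the case distinction and the selection condition in \<open>Lim_level\<close> are
  eventual conditions, so neither sees a change off a set of the ultrafilter.\<close>

lemma lim_cong:
  "eventually (\<lambda>l. \<phi> l = \<psi> l) U \<Longrightarrow> lvl_lim n \<phi> = lvl_lim n \<psi>"
proof (induction n)
  case 0
  then have "eventually (\<lambda>l. inv_into UNIV (real_atom U \<kappa>) (\<phi> l) =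
      inv_into UNIV (real_atom U \<kappa>) (\<psi> l)) U"
    by (rule eventually_mono) simp
  then show ?case by (simp add: kappa_eq_iff)
next
  case (Suc n)
  have "eventually (\<lambda>l. \<phi> l \<in> V St R n) U \<longleftrightarrow> eventually (\<lambda>l. \<psi> l \<in> V St R n) U"
    by (rule eventually_cong[OF Suc.prems]) simp
  moreover have "eventually (\<lambda>l. mem St R (\<chi> l) (\<phi> l)) U \<longleftrightarrow>
      eventually (\<lambda>l. mem St R (\<chi> l) (\<psi> l)) U" for \<chi>
    by (rule eventually_cong[OF Suc.prems]) simp
  ultimately show ?case
    using Suc.IH[OF Suc.prems] by simp
qed

lemma lim_level_independent:
  assumes "eventually (\<lambda>l. \<phi> l \<in> V St R n) U" "n \<le> m"
  shows "lvl_lim m \<phi> = lvl_lim n \<phi>"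
  using assms(2)
proof (induction m rule: dec_induct)
  case (step m)
  have "eventually (\<lambda>l. \<phi> l \<in> V St R m) U"
    using assms(1) by (rule eventually_mono) (use V_mono_level[OF step.hyps(1), of St R] in blast)
  then show ?case
    using step.IH by simp
qed simp

section \<open>Limits of set-valued functions as sets of limits of selectors\<close>

definition selections :: "nat \<Rightarrow> ('l \<Rightarrow> 'v) \<Rightarrow> 'v set" where
  "selections n \<phi> = {lvl_lim n \<chi> | \<chi>.
     (\<forall>l. \<chi> l \<in> V St R n) \<and> eventually (\<lambda>l. mem St R (\<chi> l) (\<phi> l)) U}"

lemma selections_subset: "selections n \<phi> \<subseteq> V St K n"
  by (auto simp: selections_def lim_in_V)

text \<open>Elements of a subset of level n lie in level n, so a selector into level n+1 is
  eventually in level n and can be corrected elsewhere without changing its limit.\<close>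

lemma selections_Suc:
  assumes "eventually (\<lambda>l. \<phi> l \<in> St ` Pow (V St R n)) U"
  shows "selections (Suc n) \<phi> = selections n \<phi>"
proof
  show "selections n \<phi> \<subseteq> selections (Suc n) \<phi>"
  proof
    fix z assume "z \<in> selections n \<phi>"
    then obtain \<chi> where \<chi>: "z = lvl_lim n \<chi>" "\<And>l. \<chi> l \<in> V St R n"
      "eventually (\<lambda>l. mem St R (\<chi> l) (\<phi> l)) U"
      by (auto simp: selections_def)
    have "lvl_lim (Suc n) \<chi> = lvl_lim n \<chi>"
      using \<chi>(2) by (intro lim_level_independent) auto
    then show "z \<in> selections (Suc n) \<phi>"
      using \<chi> unfolding selections_def by (auto intro!: exI[of _ \<chi>])
  qed
  show "selections (Suc n) \<phi> \<subseteq> selections n \<phi>"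
  proof
    fix z assume "z \<in> selections (Suc n) \<phi>"
    then obtain \<chi> where \<chi>: "z = lvl_lim (Suc n) \<chi>"
      "eventually (\<lambda>l. mem St R (\<chi> l) (\<phi> l)) U"
      by (auto simp: selections_def)
    have ev: "eventually (\<lambda>l. \<chi> l \<in> V St R n) U"
      using \<chi>(2) assms
      by eventually_elim (auto simp: mem_St_iff[OF sup_R])
    \<comment> \<open>Choosing a witness for equality with \<chi> l yields \<psi>, which agrees with
      \<chi> eventually and stays in level n everywhere.\<close>
    then have "eventually (\<lambda>l. \<exists>x \<in> V St R n. x = \<chi> l) U"
      by (rule eventually_mono) simp
    then obtain \<psi> where \<psi>: "\<And>l. \<psi> l \<in> V St R n" "eventually (\<lambda>l. \<psi> l = \<chi> l) U"
      using eventually_choose[of n "\<lambda>l x. x = \<chi> l"] by blast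
    have "eventually (\<lambda>l. mem St R (\<psi> l) (\<phi> l)) U"
      using \<psi>(2) \<chi>(2) by eventually_elim simp
    moreover have "z = lvl_lim n \<psi>"
      using \<chi>(1) lim_level_independent[OF ev, of "Suc n"] lim_cong[OF \<psi>(2)] by simp
    ultimately show "z \<in> selections n \<phi>"
      using \<psi>(1) unfolding selections_def by blast
  qed
qed

text \<open>Even when the recursion passes to a lower level, the result is the set of limits of
  selectors: the descent preserves \<open>selections\<close> and stops before level 0, where values
  would be urelements.\<close>

lemma lim_Suc_sets:
  "eventually (\<lambda>l. \<phi> l \<in> St ` Pow (V St R n)) U \<Longrightarrow> lvl_lim (Suc n) \<phi> = St (selections n \<phi>)"
proof (induction n)
  case 0
  have "\<not> eventually (\<lambda>l. \<phi> l \<in> V St R 0) U"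
  proof
    assume "eventually (\<lambda>l. \<phi> l \<in> V St R 0) U"
    with 0 have "eventually (\<lambda>l. False) U"
      by eventually_elim (use St_notin_base[OF sup_R, of _ 0] in auto)
    then show False by (simp add: eventually_const_iff)
  qed
  then show ?case by (simp add: selections_def)
next
  case (Suc n)
  show ?case
  proof (cases "eventually (\<lambda>l. \<phi> l \<in> V St R (Suc n)) U")
    \<comment> \<open>Sets are not urelements, so the values are eventually subsets of the level
      below, and the induction hypothesis applies.\<close>
    case True
    then have "eventually (\<lambda>l. \<phi> l \<in> R \<union> St ` Pow (V St R n)) U"
      unfolding V_Suc_eq .
    moreover have "eventually (\<lambda>l. \<phi> l \<notin> R) U"
      using Suc.prems by (rule eventually_mono) (auto simp: St_notin_base[OF sup_R] simp del: V.simps)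
    ultimately have "eventually (\<lambda>l. \<phi> l \<in> St ` Pow (V St R n)) U"
      by eventually_elim blast
    then show ?thesis
      using True Suc.IH selections_Suc[of \<phi> n]
      by (simp only: Lim_level.simps(2)[of _ _ _ "Suc n"] if_True)
  next
    case False
    then show ?thesis
      by (simp add: selections_def del: V.simps(2))
  qed
qed

section \<open>Equal limits force eventual equality\<close>

lemma selections_subset_imp:
  assumes inj: "\<And>\<chi> \<psi>. \<lbrakk>\<And>l. \<chi> l \<in> V St R n; \<And>l. \<psi> l \<in> V St R n; lvl_lim n \<chi> = lvl_lim n \<psi>\<rbrakk>
      \<Longrightarrow> eventually (\<lambda>l. \<chi> l = \<psi> l) U"
    and sub: "selections n \<phi> \<subseteq> selections n \<psi>"
  shows "\<not> eventually (\<lambda>l. \<exists>x \<in> V St R n. mem St R x (\<phi> l) \<and> \<not> mem St R x (\<psi> l)) U"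
proof
  assume "eventually (\<lambda>l. \<exists>x \<in> V St R n. mem St R x (\<phi> l) \<and> \<not> mem St R x (\<psi> l)) U"
  \<comment> \<open>The separating function: its limit belongs to the selections of \<phi>, hence to
    those of \<psi>, so it is also the limit of some \<chi>' selecting from \<psi>. By
    \<open>inj\<close> the two selectors eventually agree, which is absurd.\<close>
  then obtain \<chi> where \<chi>: "\<And>l. \<chi> l \<in> V St R n"
    "eventually (\<lambda>l. mem St R (\<chi> l) (\<phi> l) \<and> \<not> mem St R (\<chi> l) (\<psi> l)) U"
    using eventually_choose[of n "\<lambda>l x. mem St R x (\<phi> l) \<and> \<not> mem St R x (\<psi> l)"] by blast
  have "eventually (\<lambda>l. mem St R (\<chi> l) (\<phi> l)) U"
    using \<chi>(2) by (rule eventually_mono) simp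
  then have "lvl_lim n \<chi> \<in> selections n \<psi>"
    using \<chi>(1) sub unfolding selections_def by blast
  then obtain \<chi>' where \<chi>': "\<And>l. \<chi>' l \<in> V St R n"
    "eventually (\<lambda>l. mem St R (\<chi>' l) (\<psi> l)) U" "lvl_lim n \<chi> = lvl_lim n \<chi>'"
    unfolding selections_def by blast
  from inj[OF \<chi>(1) \<chi>'(1) \<chi>'(3)] \<chi>(2) \<chi>'(2) have "eventually (\<lambda>l. False) U"
    by eventually_elim simp
  then show False by (simp add: eventually_const_iff)
qed

lemma lim_atoms:
  assumes "eventually (\<lambda>l. \<phi> l \<in> R) U"
  shows "lvl_lim n \<phi> = lvl_lim 0 \<phi>"
  using assms by (intro lim_level_independent) simp_all

text \<open>Induction on the level. Membership in the level is required only eventually, so that the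
  induction hypothesis covers functions which the ultrafilter places in the lower level.\<close>

lemma lim_eq_imp:
  "eventually (\<lambda>l. \<phi> l \<in> V St R n) U \<Longrightarrow> eventually (\<lambda>l. \<psi> l \<in> V St R n) U \<Longrightarrow>
    lvl_lim n \<phi> = lvl_lim n \<psi> \<Longrightarrow> eventually (\<lambda>l. \<phi> l = \<psi> l) U"
proof (induction n arbitrary: \<phi> \<psi>)
  case 0
  then have "eventually (\<lambda>l. inv_into UNIV (real_atom U \<kappa>) (\<phi> l) =
      inv_into UNIV (real_atom U \<kappa>) (\<psi> l)) U"
    by (simp add: kappa_eq_iff)
  with 0(1,2) show ?case
    by eventually_elim (auto simp: R_atoms_def)
next
  case (Suc n)
  \<comment> \<open>Excludes the mixed cases: one limit would be an urelement of \<open>K\<close>,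
    the other a set over \<open>K\<close>.\<close>
  have atom_set: False
    if "eventually (\<lambda>l. \<alpha> l \<in> R) U" "eventually (\<lambda>l. \<beta> l \<in> St ` Pow (V St R n)) U"
      "lvl_lim (Suc n) \<alpha> = lvl_lim (Suc n) \<beta>" for \<alpha> \<beta>
  proof -
    have "lvl_lim (Suc n) \<alpha> \<in> K"
      using lim_in_V[of 0 \<alpha>] lim_atoms[OF that(1), of "Suc n"] by (simp del: Lim_level.simps)
    then show False
      using that(3) lim_Suc_sets[OF that(2)] St_notin_base[OF sup_K selections_subset]
      by (simp del: Lim_level.simps)
  qed
  have \<phi>: "eventually (\<lambda>l. \<phi> l \<in> R \<or> \<phi> l \<in> St ` Pow (V St R n)) U"
    using Suc.prems(1) unfolding V_Suc_eq by simp
  have \<psi>: "eventually (\<lambda>l. \<psi> l \<in> R \<or> \<psi> l \<in> St ` Pow (V St R n)) U"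
    using Suc.prems(2) unfolding V_Suc_eq by simp
  show ?case
  proof (rule eventually_disj_cases[OF \<phi>]; rule eventually_disj_cases[OF \<psi>])
    assume A: "eventually (\<lambda>l. \<phi> l \<in> R) U" "eventually (\<lambda>l. \<psi> l \<in> R) U"
    then have "eventually (\<lambda>l. \<phi> l \<in> V St R n) U" "eventually (\<lambda>l. \<psi> l \<in> V St R n) U"
      using V_mono_level[of 0 n St R] by (auto elim: eventually_mono)
    then show ?thesis
      using Suc.IH Suc.prems(3) by simp
  next
    assume A: "eventually (\<lambda>l. \<phi> l \<in> St ` Pow (V St R n)) U"
      "eventually (\<lambda>l. \<psi> l \<in> St ` Pow (V St R n)) U"
    have sel: "selections n \<phi> = selections n \<psi>"
      using Suc.prems(3) lim_Suc_sets[OF A(1)] lim_Suc_sets[OF A(2)]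
        St_eq_iff[OF sup_K selections_subset selections_subset]
      by (simp del: Lim_level.simps)
    \<comment> \<open>The ultrafilter turns the failure of eventual separation into eventual
      inclusion.\<close>
    have incl: "eventually (\<lambda>l. \<not> (\<exists>x \<in> V St R n. mem St R x (\<alpha> l) \<and> \<not> mem St R x (\<beta> l))) U"
      if "selections n \<alpha> \<subseteq> selections n \<beta>" for \<alpha> \<beta>
    proof -
      have "\<not> eventually (\<lambda>l. \<exists>x \<in> V St R n. mem St R x (\<alpha> l) \<and> \<not> mem St R x (\<beta> l)) U"
        by (rule selections_subset_imp[OF _ that]) (rule Suc.IH; simp)
      then show ?thesis
        using eventually_or_not by blast
    qed
    have "eventually (\<lambda>l. \<not> (\<exists>x \<in> V St R n. mem St R x (\<phi> l) \<and> \<not> mem St R x (\<psi> l))) U"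
      "eventually (\<lambda>l. \<not> (\<exists>x \<in> V St R n. mem St R x (\<psi> l) \<and> \<not> mem St R x (\<phi> l))) U"
      using sel by (intro incl; simp)+
    then show ?thesis
      using A
    proof eventually_elim
      case (elim l)
      then obtain X Y where XY: "X \<subseteq> V St R n" "Y \<subseteq> V St R n" "\<phi> l = St X" "\<psi> l = St Y"
        by auto
      then have "X = Y"
        using elim(1,2) by (auto simp: mem_St_iff[OF sup_R])
      then show ?case
        using XY by simp
    qed
  qed (use atom_set[of \<phi> \<psi>] atom_set[of \<psi> \<phi>] Suc.prems(3) in \<open>simp_all del: Lim_level.simps\<close>)
qed

section \<open>The star map as a superstructure embedding\<close>

lemma star_eq_lim:
  assumes "x \<in> V St R n"
  shows "star x = lvl_lim n (\<lambda>_. x)"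
proof -
  \<comment> \<open>The least level, at which \<open>Lambda_Lim\<close> evaluates the constant
    function.\<close>
  define m where "m = (LEAST n. x \<in> V St R n)"
  have "x \<in> V St R m" "m \<le> n"
    unfolding m_def using assms by (auto intro: LeastI Least_le)
  then have "lvl_lim n (\<lambda>_. x) = lvl_lim m (\<lambda>_. x)"
    by (intro lim_level_independent) auto
  then show ?thesis
    by (simp add: Lambda_star_def Lambda_Lim_def m_def)
qed

lemma star_in_V: "x \<in> V St R n \<Longrightarrow> star x \<in> V St K n"
  by (simp add: star_eq_lim lim_in_V)

lemma V_inf_common_level:
  assumes "x \<in> V_inf St R" "y \<in> V_inf St R"
  obtains n where "x \<in> V St R n" "y \<in> V St R n"
proof -
  from assms obtain i j where "x \<in> V St R i" "y \<in> V St R j"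
    by (auto simp: V_inf_def)
  then show ?thesis
    using that[of "max i j"] V_mono_level[of i "max i j" St R] V_mono_level[of j "max i j" St R]
    by auto
qed

text \<open>Equal limits make the two constant functions eventually equal, and a proper filter makes
  their values equal.\<close>

lemma inj_on_star: "inj_on star (V_inf St R)"
proof (rule inj_onI)
  fix x y assume "x \<in> V_inf St R" "y \<in> V_inf St R" and eq: "star x = star y"
  then obtain n where n: "x \<in> V St R n" "y \<in> V St R n"
    using V_inf_common_level by blast
  then show "x = y"
    using lim_eq_imp[of "\<lambda>_. x" n "\<lambda>_. y"] eq
    by (simp add: star_eq_lim[of _ n] eventually_const_iff)
qed

lemma star_real:
  assumes "r \<in> R"
  shows "star r = r"
proof -
  obtain c where c: "r = real_atom U \<kappa> c"
    using assms by (auto simp: R_atoms_def)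
  have "star r = lvl_lim 0 (\<lambda>_. r)"
    using assms by (intro star_eq_lim) simp
  also have "\<dots> = \<kappa> (const_Lim U c)"
    by (simp add: c const_Lim_def)
  finally show ?thesis
    by (simp add: c real_atom_def)
qed

text \<open>The usual ultrapower extension of a set: selectors from a constant set are the functions
  eventually valued in it.\<close>

lemma star_St:
  assumes "Y \<subseteq> V St R n"
  shows "star (St Y) = St {lvl_lim n \<chi> | \<chi>. (\<forall>l. \<chi> l \<in> V St R n) \<and> eventually (\<lambda>l. \<chi> l \<in> Y) U}"
proof -
  have "star (St Y) = lvl_lim (Suc n) (\<lambda>_. St Y)"
    using assms by (intro star_eq_lim) auto
  also have "\<dots> = St (selections n (\<lambda>_. St Y))"
    using assms by (intro lim_Suc_sets) auto
  finally show ?thesis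
    by (simp add: selections_def mem_St_iff[OF sup_R assms])
qed

lemma star_St_R: "star (St R) = St K"
proof -
  have "{lvl_lim 0 \<chi> | \<chi>. (\<forall>l. \<chi> l \<in> R) \<and> eventually (\<lambda>l. \<chi> l \<in> R) U} = K"
  proof (intro equalityI subsetI)
    fix z assume "z \<in> K"
    then obtain f where "z = \<kappa> (real_Lim U f)"
      by (auto simp: K_eq)
    \<comment> \<open>A representative of the class is lifted to real urelements;
      \<open>inv_real_atom\<close> recovers it.\<close>
    then have "z = lvl_lim 0 (\<lambda>l. real_atom U \<kappa> (f l))" by simp
    then show "z \<in> {lvl_lim 0 \<chi> | \<chi>. (\<forall>l. \<chi> l \<in> R) \<and> eventually (\<lambda>l. \<chi> l \<in> R) U}"
      by (auto simp: R_atoms_def simp del: Lim_level.simps)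
  qed (use lim_in_V[of 0] in auto)
  then show ?thesis
    using star_St[of R 0] by simp
qed

lemma mem_star_iff:
  assumes "x \<in> V_inf St R" "y \<in> V_inf St R"
  shows "mem St R x y \<longleftrightarrow> mem St K (star x) (star y)"
  using assms(2)
proof (cases rule: V_inf_cases)
  \<comment> \<open>The star map fixes urelements, and these have no members in either
    superstructure.\<close>
  case 1
  then show ?thesis
    using star_real R_subset_K not_mem_base[OF sup_R] not_mem_base[OF sup_K] by auto
next
  case (2 m Y)
  obtain k where "x \<in> V St R k"
    using assms(1) by (auto simp: V_inf_def)
  then obtain n where n: "x \<in> V St R n" "Y \<subseteq> V St R n"
    using 2(1) V_mono_level[of k "max k m" St R] V_mono_level[of m "max k m" St R]
    by (metis max.cobounded1 max.cobounded2 order_trans subsetD)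
  let ?A = "{lvl_lim n \<chi> | \<chi>. (\<forall>l. \<chi> l \<in> V St R n) \<and> eventually (\<lambda>l. \<chi> l \<in> Y) U}"
  have A: "?A \<subseteq> V St K n"
    by (auto simp: lim_in_V)
  have "x \<in> Y \<longleftrightarrow> star x \<in> ?A"
  proof
    assume "x \<in> Y"
    then show "star x \<in> ?A"
      using n by (auto simp: star_eq_lim intro!: exI[of _ "\<lambda>_. x"])
  next
    assume "star x \<in> ?A"
    then obtain \<chi> where \<chi>: "\<And>l. \<chi> l \<in> V St R n" "eventually (\<lambda>l. \<chi> l \<in> Y) U"
      "lvl_lim n (\<lambda>_. x) = lvl_lim n \<chi>"
      using star_eq_lim[OF n(1)] by auto
    \<comment> \<open>Injectivity of limits identifies the constant x with a function eventually
      valued in \<open>Y\<close>.\<close>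
    have "eventually (\<lambda>l. x = \<chi> l) U"
      using n(1) \<chi>(1,3) by (intro lim_eq_imp[of _ n]) auto
    with \<chi>(2) have "eventually (\<lambda>l. x \<in> Y) U"
      by eventually_elim simp
    then show "x \<in> Y" by (simp add: eventually_const_iff)
  qed
  then show ?thesis
    using mem_St_iff[OF sup_R n(2)] mem_St_iff[OF sup_K A] star_St[OF n(2)] 2(2) by simp
qed

lemma superstructure_embedding_star:
  assumes "range (const_Lim U) \<subset> carrier (Lambda_field U)"
  shows "superstructure_embedding St R K star"
proof -
  \<comment> \<open>A class without constant representative; injectivity of \<kappa> keeps its image
    out of \<open>R\<close>.\<close>
  obtain a where a: "a \<in> carrier (Lambda_field U)" "a \<notin> range (const_Lim U)"
    using assms by blast
  have "\<kappa> a \<notin> R"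
    using a assms inj_on_eq_iff[OF inj_kappa a(1)]
    by (auto simp: R_atoms_def real_atom_def)
  then have "R \<subset> K"
    using R_subset_K a(1) by (auto simp: K_atoms_def)
  moreover have "star ` V_inf St R \<subseteq> V_inf St K"
    using star_in_V unfolding V_inf_def by blast
  ultimately show ?thesis
    unfolding superstructure_embedding_def
    using inj_on_star star_real star_St_R mem_star_iff by simp
qed

section \<open>Leibniz' principle\<close>

lemma Lambda_holds_sentence_iff:
  assumes "bounded_fm p" "fvars p = {}" "set_fm p \<subseteq> V_inf St R"
  shows "Lambda_holds St U \<kappa> (map_fm star p) \<xi> \<longleftrightarrow> sat_V St R p e"
proof -
  \<comment> \<open>\<open>Lambda_holds\<close> allows any preimage of the starred sentence;
    injectivity of \<open>star\<close> on the constants leaves only \<open>p\<close>.\<close>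
  have "q = p" if "set_fm q \<subseteq> V_inf St R" "map_fm star p = map_fm star q" for q
    using that assms(3) inj_onD[OF inj_on_star]
    by (intro fm.inj_map_strong[of q p star star]) auto
  \<comment> \<open>A sentence has the same truth value at every index, so eventual truth is
    truth.\<close>
  moreover have "eventually (\<lambda>l. sat_V St R p (\<lambda>i. \<phi> i l)) U \<longleftrightarrow> sat_V St R p e" for \<phi>
  proof -
    have "sat_V St R p (\<lambda>i. \<phi> i l) = sat_V St R p e" for l
      using assms(2) by (intro sat_cong) simp
    then show ?thesis
      by (simp add: eventually_const_iff)
  qed
  ultimately show ?thesis
    using assms unfolding Lambda_holds_def by blast
qed

lemma nonstandard_universe_star:
  assumes "range (const_Lim U) \<subset> carrier (Lambda_field U)"
  shows "nonstandard_universe St R K star (Lambda_holds St U \<kappa>)"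
proof -
  \<comment> \<open>An assignment valid in both superstructures, so that neither quantifier over
    assignments is vacuous.\<close>
  let ?e = "\<lambda>_ :: nat. real_atom U \<kappa> 0"
  have e: "?e \<in> UNIV \<rightarrow> V_inf St R" "?e \<in> UNIV \<rightarrow> V_inf St K"
    using real_atom_in_V[of 0] R_subset_K in_V_imp_in_V_inf[of _ St R 0]
      in_V_imp_in_V_inf[of _ St K 0]
    by auto
  have "(\<forall>e \<in> UNIV \<rightarrow> V_inf St R. sat_V St R p e) \<longleftrightarrow>
      (\<forall>e \<in> UNIV \<rightarrow> V_inf St K. Lambda_holds St U \<kappa> (map_fm star p) e)"
    if "bounded_fm p" "fvars p = {}" "set_fm p \<subseteq> V_inf St R" for p
    using Lambda_holds_sentence_iff[OF that] e by blast
  then show ?thesis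
    unfolding nonstandard_universe_def
    using superstructure_embedding_star[OF assms] by blast
qed

end

theorem theorem38:
  fixes U :: "'l filter"
    and St :: "'v set \<Rightarrow> 'v"
    and \<kappa> :: "('l \<Rightarrow> real) set \<Rightarrow> 'v"
  assumes "infinite (UNIV :: 'l set)"
    and "free_ultrafilter U"
    and "inj_on \<kappa> (carrier (Lambda_field U))"
    and "superstructure_over St (K_atoms U \<kappa>)"
    and "range (const_Lim U) \<subset> carrier (Lambda_field U)"
  shows "nonstandard_universe St (R_atoms U \<kappa>) (K_atoms U \<kappa>)
           (Lambda_star St U \<kappa>) (Lambda_holds St U \<kappa>)"
proof -
  interpret Lambda_superstructure U St \<kappa>
    using assms(2-4) by unfold_locales
  show ?thesis
    using assms(5) by (rule nonstandard_universe_star)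
qed

end
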